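(* Let $N_q\ge 0$ be an integer and $a>0$. Let $\xi_0,\dots,\xi_{N_q}$ and $q_0,\dots,q_{N_q}$ be the abscissae and weights of the $(N_q+1)$-point Gauss–Hermite quadrature rule for the weight function $\omega(x)=\frac1{\sqrt{2\pi}}e^{-x^2/2}$ on $\mathbb R$. Then the linear system in the unknowns $w_0,\dots,w_{N_q}$, $$H_n(0)^2\,w_0+2\sum_{k=1}^{N_q}H_n(ka)^2\,w_k=n!,\qquad n=0,1,\dots,N_q,$$ has the solution $$w_k=\sum_{i=0}^{N_q}q_i\,l_k^{N_q}\!\left(\frac{\xi_i}{a}\right),\qquad k=0,\dots,N_q,$$ where $$l_k^{N}(x)=\prod_{\substack{j=-N\\ j\ne k}}^{N}\frac{x-j}{k-j}.$$
   Context: Probabilist's Hermite polynomials: $H_n(x)=(-1)^n e^{x^2/2}\frac{d^n}{dx^n}e^{-x^2/2}$. The $(N_q+1)$-point Gauss–Hermite rule is the one whose abscissae are the roots of $H_{N_q+1}$ and which satisfies $\sum_i q_i p(\xi_i)=\int_{\mathbb R}p(x)\omega(x)\,dx$ for all polynomials $p$ of degree at most $2N_q+1$. *)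

theory Defs
  imports "HOL-Probability.Distributions" "HOL-Computational_Algebra.Polynomial"
begin

definition hermite :: "nat \<Rightarrow> real \<Rightarrow> real" where
  "hermite n x = (- 1) ^ n * exp (x\<^sup>2 / 2) * (deriv ^^ n) (\<lambda>t. exp (- t\<^sup>2 / 2)) x"

text \<open>The rule with \<open>N + 1\<close> points, indexed by \<open>0, \<dots>, N\<close>. The bijection says that
  the nodes list every real root of \<open>hermite (N + 1)\<close> exactly once, in any order.\<close>

definition gauss_hermite_rule :: "nat \<Rightarrow> (nat \<Rightarrow> real) \<Rightarrow> (nat \<Rightarrow> real) \<Rightarrow> bool" where
  "gauss_hermite_rule N \<xi> q \<longleftrightarrow>
     bij_betw \<xi> {0..N} {x. hermite (N + 1) x = 0} \<and>
     (\<forall>p :: real poly. degree p \<le> 2 * N + 1 \<longrightarrow>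
        (\<Sum>i=0..N. q i * poly p (\<xi> i)) = (LINT x|lborel. poly p x * std_normal_density x))"

definition lagrange_basis :: "nat \<Rightarrow> int \<Rightarrow> real \<Rightarrow> real" where
  "lagrange_basis N k x =
     (\<Prod>j\<in>{- int N..int N} - {k}. (x - of_int j) / (of_int k - of_int j))"

end

(* Extend w to an even function on {-N..N} and let L p = sum_j w_|j| p(j a). By parity of H_n^2
   the system says that L agrees with the Gaussian expectation on H_0^2, ..., H_N^2. Both
   functionals are invariant under p(x) -> p(-x) and H_n^2 is monic of degree 2n, so this is
   the same as agreement on all polynomials of degree at most 2N. By Lagrange interpolation at the
   2N + 1 points j a it is enough to test on the Lagrange basis, where L takes the value w_k and
   where the Gauss-Hermite rule computes the expectation exactly. *)
theory Submission
  imports Defs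
begin

section \<open>Hermite polynomials\<close>

text \<open>The derivative of P(x) exp(-x^2/2) is -(x P - P') exp(-x^2/2). This recurrence therefore
  reproduces the iterated derivatives of the Gaussian, with the sign (-1)^n split off.\<close>

fun hermite_poly :: "nat \<Rightarrow> real poly" where
  "hermite_poly 0 = 1"
| "hermite_poly (Suc n) = [:0, 1:] * hermite_poly n - pderiv (hermite_poly n)"

lemma higher_deriv_gaussian:
  "(deriv ^^ n) (\<lambda>t::real. exp (- t\<^sup>2 / 2)) =
     (\<lambda>x. (- 1) ^ n * poly (hermite_poly n) x * exp (- x\<^sup>2 / 2))"
proof (induction n)
  case (Suc n)
  have "((\<lambda>x. (- 1) ^ n * poly (hermite_poly n) x * exp (- x\<^sup>2 / 2)) has_real_derivative
      (- 1) ^ Suc n * poly (hermite_poly (Suc n)) x * exp (- x\<^sup>2 / 2)) (at x)" for x :: real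
    by (auto intro!: derivative_eq_intros poly_DERIV simp: algebra_simps)
  then show ?case
    using Suc by (auto intro!: DERIV_imp_deriv)
qed simp

lemma hermite_eq_poly: "hermite n x = poly (hermite_poly n) x"
proof -
  have "hermite n x =
      ((- 1) ^ n * (- 1) ^ n) * (exp (x\<^sup>2 / 2) * exp (- x\<^sup>2 / 2)) * poly (hermite_poly n) x"
    unfolding hermite_def higher_deriv_gaussian by (simp only: mult_ac)
  also have "\<dots> = poly (hermite_poly n) x"
    by (simp add: mult_exp_exp flip: power_mult_distrib)
  finally show ?thesis .
qed

lemma degree_hermite_poly_le: "degree (hermite_poly n) \<le> n"
proof (induction n)
  case (Suc n)
  have "degree ([:0, 1:] * hermite_poly n) \<le> Suc n"
    using Suc degree_mult_le[of "[:0, 1:]" "hermite_poly n"] by simp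
  moreover have "degree (pderiv (hermite_poly n)) \<le> Suc n"
    using Suc by (simp add: degree_pderiv)
  ultimately show ?case
    by (simp add: degree_diff_le)
qed simp

lemma coeff_hermite_poly_self: "coeff (hermite_poly n) n = 1"
proof (induction n)
  case (Suc n)
  have "coeff (pderiv (hermite_poly n)) (Suc n) = 0"
    by (rule coeff_eq_0) (use degree_hermite_poly_le[of n] in \<open>simp add: degree_pderiv\<close>)
  with Suc show ?case by simp
qed simp

lemma degree_hermite_poly: "degree (hermite_poly n) = n"
  using degree_hermite_poly_le[of n] le_degree[of "hermite_poly n" n]
  by (simp add: coeff_hermite_poly_self)

text \<open>Both terms of the recurrence change parity: multiplication by x flips the sign under
  reflection, and so does differentiation by the chain rule.\<close>

lemma hermite_poly_reflect:
  "pcompose (hermite_poly n) [:0, -1:] = smult ((- 1) ^ n) (hermite_poly n)"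
proof (induction n)
  case (Suc n)
  have "pderiv (pcompose (hermite_poly n) [:0, -1:]) = smult ((- 1) ^ n) (pderiv (hermite_poly n))"
    by (simp add: Suc pderiv_smult)
  then have "pcompose (pderiv (hermite_poly n)) [:0, -1:] =
      smult ((- 1) ^ Suc n) (pderiv (hermite_poly n))"
    by (simp add: pderiv_pcompose pderiv_pCons minus_equation_iff)
  with Suc show ?case
    by (simp add: pcompose_diff pcompose_mult pcompose_pCons algebra_simps smult_diff_right)
qed (simp add: pcompose_1)

lemma hermite_minus: "hermite n (- x) = (- 1) ^ n * hermite n x"
  using arg_cong[OF hermite_poly_reflect, of "\<lambda>p. poly p x" n]
  by (simp add: hermite_eq_poly poly_pcompose)

section \<open>Gaussian expectation of polynomials\<close>

definition gauss_expectation :: "real poly \<Rightarrow> real" where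
  "gauss_expectation p = (LINT x|lborel. poly p x * std_normal_density x)"

lemma integrable_poly_gaussian:
  "integrable lborel (\<lambda>x. poly p x * std_normal_density x)"
  unfolding poly_altdef sum_distrib_right
  using integrable_std_normal_moment
  by (intro Bochner_Integration.integrable_sum)
     (auto simp: mult.assoc mult.commute[of "_ ^ _" "std_normal_density _"])

lemma gauss_expectation_add:
  "gauss_expectation (p + q) = gauss_expectation p + gauss_expectation q"
  by (simp add: gauss_expectation_def distrib_right integrable_poly_gaussian)

lemma gauss_expectation_smult: "gauss_expectation (smult c p) = c * gauss_expectation p"
  by (simp add: gauss_expectation_def mult.assoc)

lemma gauss_expectation_diff:
  "gauss_expectation (p - q) = gauss_expectation p - gauss_expectation q"
  by (simp add: gauss_expectation_def left_diff_distrib integrable_poly_gaussian)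

lemma gauss_expectation_0 [simp]: "gauss_expectation 0 = 0"
  by (simp add: gauss_expectation_def)

lemma gauss_expectation_sum: "gauss_expectation (sum f A) = (\<Sum>i\<in>A. gauss_expectation (f i))"
  by (induction A rule: infinite_finite_induct) (simp_all add: gauss_expectation_add)

lemma gauss_expectation_reflect:
  "gauss_expectation (pcompose p [:0, -1:]) = gauss_expectation p"
  using lborel_integral_real_affine[of "-1" "\<lambda>x. poly p x * std_normal_density x" 0]
  by (simp add: gauss_expectation_def poly_pcompose normal_density_def)

lemma gauss_expectation_monom:
  "gauss_expectation (monom 1 k) = (if even k then fact k / (2 ^ (k div 2) * fact (k div 2)) else 0)"
proof (cases "even k")
  case True
  then obtain m where "k = 2 * m" by (rule evenE)
  then show ?thesis
    using std_normal_moment_even[of m]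
    by (simp add: gauss_expectation_def poly_monom mult.commute has_bochner_integral_integral_eq)
next
  case False
  then obtain m where "k = 2 * m + 1" by (rule oddE)
  then show ?thesis
    using std_normal_moment_odd[of m]
    by (simp add: gauss_expectation_def poly_monom mult.commute has_bochner_integral_integral_eq)
qed

text \<open>Gaussian integration by parts, E[x p] = E[p']. By linearity it reduces to monomials,
  where it is the moment recursion E[x^(k+1)] = k E[x^(k-1)].\<close>

lemma gauss_expectation_parts:
  "gauss_expectation ([:0, 1:] * p) = gauss_expectation (pderiv p)"
proof -
  have monom: "gauss_expectation ([:0, 1:] * monom 1 k) = gauss_expectation (pderiv (monom 1 k))" for k
  proof -
    \<comment> \<open>At k = 0 the truncated exponent \<open>k - 1\<close> is harmless, since the
      factor k vanishes and E[x] = 0.\<close>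
    have "gauss_expectation (monom 1 (Suc k)) = of_nat k * gauss_expectation (monom 1 (k - 1))"
    proof (cases "odd k")
      case True
      then obtain m where m: "k = 2 * m + 1" by (rule oddE)
      \<comment> \<open>Consecutive even moments have ratio 2m + 1: a factor 2m + 2 splits off from
        both numerator and denominator.\<close>
      have "fact (2 * m + 2) / (2 ^ (m + 1) * fact (m + 1)) =
          (2 * real m + 2) * ((2 * real m + 1) * fact (2 * m)) / ((2 * real m + 2) * (2 ^ m * fact m))"
        by (simp add: algebra_simps)
      also have "\<dots> = (2 * real m + 1) * (fact (2 * m) / (2 ^ m * fact m))"
        by (subst mult_divide_mult_cancel_left) simp_all
      finally show ?thesis
        by (simp add: m gauss_expectation_monom)
    next
      case False
      then show ?thesis by (cases k) (simp_all add: gauss_expectation_monom)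
    qed
    moreover have "pderiv (monom (1::real) k) = smult (of_nat k) (monom 1 (k - 1))"
      by (simp add: pderiv_monom smult_monom)
    ultimately show ?thesis
      by (simp add: gauss_expectation_smult flip: monom_Suc)
  qed
  have p: "p = (\<Sum>i\<le>degree p. smult (coeff p i) (monom 1 i))"
    by (simp add: smult_monom poly_as_sum_of_monoms)
  have "gauss_expectation ([:0, 1:] * p) =
      (\<Sum>i\<le>degree p. gauss_expectation ([:0, 1:] * smult (coeff p i) (monom 1 i)))"
    by (subst p) (simp only: sum_distrib_left gauss_expectation_sum)
  also have "\<dots> = (\<Sum>i\<le>degree p. gauss_expectation (pderiv (smult (coeff p i) (monom 1 i))))"
    by (simp only: mult_smult_right gauss_expectation_smult monom pderiv_smult)
  also have "\<dots> = gauss_expectation (pderiv p)"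
    by (subst (3) p) (simp only: gauss_expectation_sum higher_pderiv_sum[of 1, simplified])
  finally show ?thesis .
qed

text \<open>Each integration by parts moves one derivative onto p. The product rule also yields a
  term with the derivative of H_n, which the second term of the recurrence cancels.\<close>

lemma gauss_expectation_hermite_mult:
  "gauss_expectation (hermite_poly n * p) = gauss_expectation ((pderiv ^^ n) p)"
proof (induction n arbitrary: p)
  case (Suc n)
  have "hermite_poly (Suc n) * p =
      [:0, 1:] * (hermite_poly n * p) - pderiv (hermite_poly n) * p"
    by (simp add: algebra_simps)
  then have "gauss_expectation (hermite_poly (Suc n) * p) =
      gauss_expectation (pderiv (hermite_poly n * p)) - gauss_expectation (pderiv (hermite_poly n) * p)"
    by (simp only: gauss_expectation_diff gauss_expectation_parts)
  also have "\<dots> = gauss_expectation (hermite_poly n * pderiv p)"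
    by (simp add: pderiv_mult gauss_expectation_add mult.commute)
  also have "\<dots> = gauss_expectation ((pderiv ^^ n) (pderiv p))"
    by (rule Suc)
  finally show ?case by (simp add: funpow_swap1)
qed simp

lemma higher_pderiv_const:
  fixes p :: "real poly"
  assumes "degree p = n"
  shows "(pderiv ^^ n) p = [:fact n * lead_coeff p:]"
  using assms
proof (induction n arbitrary: p)
  case 0
  then show ?case by (auto elim: degree_eq_zeroE)
next
  case (Suc n)
  then have "degree (pderiv p) = n" by (simp add: degree_pderiv)
  from Suc.IH[OF this] Suc.prems this show ?case
    by (simp add: funpow_swap1 coeff_pderiv algebra_simps del: of_nat_Suc)
qed

text \<open>Moving n derivatives onto the second factor H_n leaves the constant n!, because H_n is
  monic. This identifies the right-hand sides of the linear system as expectations.\<close>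

lemma gauss_expectation_hermite_square: "gauss_expectation ((hermite_poly n)\<^sup>2) = fact n"
proof -
  have "gauss_expectation [:fact n:] = fact n * gauss_expectation (monom 1 0)"
    by (simp flip: gauss_expectation_smult)
  then have "gauss_expectation [:fact n:] = fact n"
    by (simp only: gauss_expectation_monom) simp
  then show ?thesis
    by (simp add: power2_eq_square gauss_expectation_hermite_mult higher_pderiv_const
        degree_hermite_poly coeff_hermite_poly_self gauss_expectation_monom)
qed

section \<open>Lagrange interpolation at equispaced nodes\<close>

text \<open>The rescaled Lagrange basis as an actual polynomial in x, so that degree bounds and the
  exactness of the quadrature rule apply to it.\<close>

definition lagrange_poly :: "nat \<Rightarrow> real \<Rightarrow> int \<Rightarrow> real poly" where
  "lagrange_poly N a k =
     (\<Prod>j\<in>{- int N..int N} - {k}. smult (1 / of_int (k - j)) [:- of_int j, 1 / a:])"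

lemma poly_lagrange_poly: "poly (lagrange_poly N a k) x = lagrange_basis N k (x / a)"
  unfolding lagrange_poly_def lagrange_basis_def poly_prod
  by (intro prod.cong) (simp_all add: diff_divide_distrib)

lemma degree_lagrange_poly:
  assumes "k \<in> {- int N..int N}"
  shows "degree (lagrange_poly N a k) \<le> 2 * N"
proof -
  have "degree (lagrange_poly N a k) \<le>
      (\<Sum>j\<in>{- int N..int N} - {k}. degree (smult (1 / of_int (k - j)) [:- of_int j, 1 / a:]))"
    unfolding lagrange_poly_def by (rule degree_prod_sum_le[unfolded o_def]) simp
  also have "\<dots> \<le> (\<Sum>j\<in>{- int N..int N} - {k}. 1)"
    by (intro sum_mono) simp
  also have "\<dots> = 2 * N"
    using assms by (simp add: card_Diff_singleton)
  finally show ?thesis .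
qed

lemma lagrange_basis_of_int:
  assumes "i \<in> {- int N..int N}"
  shows "lagrange_basis N k (of_int i) = (if i = k then 1 else 0)"
  using assms by (auto simp: lagrange_basis_def intro!: prod.neutral)

text \<open>Replacing j by -j negates numerator and denominator of every factor, so the signs
  cancel.\<close>

lemma lagrange_basis_reflect: "lagrange_basis N (- k) x = lagrange_basis N k (- x)"
  unfolding lagrange_basis_def
  by (rule prod.reindex_bij_witness[of _ uminus uminus])
     (auto simp: field_simps)

text \<open>Both sides have degree at most 2N and agree at the 2N + 1 nodes j a, which are distinct
  because a is nonzero.\<close>

lemma lagrange_interpolation:
  assumes "a \<noteq> 0" "degree p \<le> 2 * N"
  shows "p = (\<Sum>j\<in>{- int N..int N}. smult (poly p (of_int j * a)) (lagrange_poly N a j))"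
proof (rule poly_eqI_degree[where A = "(\<lambda>j. of_int j * a) ` {- int N..int N}"])
  have card: "card ((\<lambda>j. of_int j * a) ` {- int N..int N}) = 2 * N + 1"
    using assms by (subst card_image) (auto simp: inj_on_def)
  show "degree p < card ((\<lambda>j. of_int j * a) ` {- int N..int N})"
    using assms card by simp
  have "degree (\<Sum>j\<in>{- int N..int N}. smult (poly p (of_int j * a)) (lagrange_poly N a j)) \<le> 2 * N"
    by (intro degree_sum_le) (auto intro!: order_trans[OF degree_smult_le] degree_lagrange_poly)
  then show "degree (\<Sum>j\<in>{- int N..int N}. smult (poly p (of_int j * a)) (lagrange_poly N a j))
      < card ((\<lambda>j. of_int j * a) ` {- int N..int N})"
    using card by simp
next
  fix x assume "x \<in> (\<lambda>j. of_int j * a) ` {- int N..int N}"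
  then obtain i where i: "i \<in> {- int N..int N}" "x = of_int i * a" by auto
  then show "poly p x =
      poly (\<Sum>j\<in>{- int N..int N}. smult (poly p (of_int j * a)) (lagrange_poly N a j)) x"
    using assms by (simp add: poly_sum poly_lagrange_poly lagrange_basis_of_int mult_delta_right)
qed

section \<open>Symmetric functionals\<close>

lemma sum_symmetric_int:
  fixes f :: "int \<Rightarrow> real"
  assumes "\<And>j. f (- j) = f j"
  shows "(\<Sum>j\<in>{- int N..int N}. f j) = f 0 + 2 * (\<Sum>k=1..N. f (int k))"
proof (induction N)
  case (Suc N)
  have "{- int (Suc N)..int (Suc N)} = insert (- int (Suc N)) (insert (int (Suc N)) {- int N..int N})"
    by auto
  with Suc assms[of "int (Suc N)"] show ?case by simp
qed simp

text \<open>The squares of H_n reach only even degrees, but reflection invariance gives D r = D (r +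
  r(-x)) / 2, so odd coefficients never matter. Induction lowers the degree by two at a time; the
  lemma serves for the difference of two functionals.\<close>

lemma symmetric_functional_eq_0:
  fixes D :: "real poly \<Rightarrow> real"
  assumes add: "\<And>p q. D (p + q) = D p + D q"
    and smult: "\<And>c p. D (smult c p) = c * D p"
    and reflect: "\<And>p. D (pcompose p [:0, -1:]) = D p"
    and hermite: "\<And>n. n \<le> N \<Longrightarrow> D ((hermite_poly n)\<^sup>2) = 0"
    and "degree p \<le> 2 * N"
  shows "D p = 0"
proof -
  have "D p = 0" if "m \<le> N" "degree p \<le> 2 * m" for m p
    using that
  proof (induction m arbitrary: p)
    case 0
    then obtain c where "p = smult c ((hermite_poly 0)\<^sup>2)"
      by (auto elim: degree_eq_zeroE)
    with hermite[of 0] show ?case by (simp only: smult)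
  next
    case (Suc m)
    define h where "h = (hermite_poly (Suc m))\<^sup>2"
    define c where "c = coeff p (2 * Suc m)"
    \<comment> \<open>Since \<open>h\<close> is monic of degree 2m + 2, this subtraction removes the
      top coefficient of \<open>p\<close>.\<close>
    define r where "r = p - smult c h"
    have "degree h = 2 * Suc m"
      using coeff_hermite_poly_self[of "Suc m"]
      by (subst h_def, subst degree_power_eq) (auto simp: degree_hermite_poly simp del: hermite_poly.simps)
    moreover have "coeff h (2 * Suc m) = 1"
      using coeff_mult_degree_sum[of "hermite_poly (Suc m)" "hermite_poly (Suc m)"]
      unfolding h_def power2_eq_square degree_hermite_poly coeff_hermite_poly_self
      by (simp only: mult_2 mult_1)
    ultimately have r: "coeff r i = 0" if "i \<ge> 2 * Suc m" for i
      using that Suc.prems by (cases "i = 2 * Suc m") (auto simp: r_def c_def coeff_eq_0)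
    \<comment> \<open>Symmetrising kills the coefficient of odd degree \<open>2 * m + 1\<close>.\<close>
    let ?s = "r + pcompose r [:0, -1:]"
    have "degree ?s \<le> 2 * m"
    proof (rule degree_le, intro allI impI)
      fix i assume "2 * m < i"
      then consider "i = 2 * m + 1" | "i \<ge> 2 * Suc m" by fastforce
      then show "coeff ?s i = 0"
        by cases (auto simp: coeff_pcompose_linear r)
    qed
    then have "D ?s = 0" using Suc by simp
    then have "D r = 0" by (simp add: add reflect)
    moreover have "D p = D r + c * D h"
      by (simp add: r_def flip: add smult)
    ultimately show ?case using hermite[of "Suc m"] Suc.prems by (simp add: h_def)
  qed
  then show ?thesis using assms by blast
qed

section \<open>The evenly weighted sum over the equispaced nodes\<close>

definition node_functional :: "nat \<Rightarrow> real \<Rightarrow> (nat \<Rightarrow> real) \<Rightarrow> real poly \<Rightarrow> real" where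
  "node_functional N a w p = (\<Sum>j\<in>{- int N..int N}. w (nat \<bar>j\<bar>) * poly p (of_int j * a))"

text \<open>The square of H_n is even, so the nodes j a and -j a contribute equally; this pairing is
  the factor 2 in the system.\<close>

lemma node_functional_hermite_square:
  "node_functional N a w ((hermite_poly n)\<^sup>2) =
     (hermite n 0)\<^sup>2 * w 0 + 2 * (\<Sum>k=1..N. (hermite n (real k * a))\<^sup>2 * w k)"
proof -
  have "node_functional N a w ((hermite_poly n)\<^sup>2) =
      (\<Sum>j\<in>{- int N..int N}. (hermite n (of_int j * a))\<^sup>2 * w (nat \<bar>j\<bar>))"
    by (simp add: node_functional_def hermite_eq_poly mult.commute)
  also have "\<dots> = (hermite n (of_int 0 * a))\<^sup>2 * w (nat \<bar>0\<bar>) +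
      2 * (\<Sum>k=1..N. (hermite n (of_int (int k) * a))\<^sup>2 * w (nat \<bar>int k\<bar>))"
    by (rule sum_symmetric_int) (simp add: hermite_minus power_mult_distrib flip: power_mult)
  finally show ?thesis by simp
qed

lemma node_functional_reflect:
  "node_functional N a w (pcompose p [:0, -1:]) = node_functional N a w p"
  unfolding node_functional_def
  by (rule sum.reindex_bij_witness[of _ uminus uminus]) (auto simp: poly_pcompose)

text \<open>Although the weight w_k sits at both k a and -k a, for k > 0 the polynomial vanishes at
  the second node, so w_k is counted once.\<close>

lemma node_functional_lagrange:
  assumes "a \<noteq> 0" "k \<le> N"
  shows "node_functional N a w (lagrange_poly N a (int k)) = w k"
  using assms
  by (simp add: node_functional_def poly_lagrange_poly lagrange_basis_of_int mult_delta_right)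

text \<open>Reflection exchanges the basis polynomials of k and -k and preserves the expectation.
  Hence the weights, prescribed only for k >= 0, also fit the negative nodes.\<close>

lemma gauss_expectation_lagrange_abs:
  "gauss_expectation (lagrange_poly N a \<bar>k\<bar>) = gauss_expectation (lagrange_poly N a k)"
proof -
  have "lagrange_poly N a (- k) = pcompose (lagrange_poly N a k) [:0, -1:]"
    by (simp add: poly_pcompose poly_lagrange_poly lagrange_basis_reflect fun_eq_iff
        flip: poly_eq_poly_eq_iff)
  then show ?thesis by (simp add: abs_if gauss_expectation_reflect)
qed

text \<open>The equivalence for arbitrary \<open>w\<close> gives existence and uniqueness of the
  solution on the indices 0, ..., N.\<close>

theorem mainTheorem3:
  fixes N :: nat and a :: real and \<xi> q :: "nat \<Rightarrow> real"
  assumes "a > 0"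
    and "gauss_hermite_rule N \<xi> q"
  shows "\<forall>w :: nat \<Rightarrow> real.
    (\<forall>n\<in>{0..N}. (hermite n 0)\<^sup>2 * w 0 + 2 * (\<Sum>k=1..N. (hermite n (real k * a))\<^sup>2 * w k) = fact n)
    \<longleftrightarrow> (\<forall>k\<in>{0..N}. w k = (\<Sum>i=0..N. q i * lagrange_basis N (int k) (\<xi> i / a)))"
proof
  fix w :: "nat \<Rightarrow> real"
  let ?L = "node_functional N a w"
  \<comment> \<open>This condition is the middle link: the system and the explicit formula are each
    shown equivalent to it.\<close>
  define exact where "exact \<longleftrightarrow> (\<forall>p. degree p \<le> 2 * N \<longrightarrow> ?L p = gauss_expectation p)"
  \<comment> \<open>The rule is exact up to degree 2N + 1, and the Lagrange polynomial has degree at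
    most 2N.\<close>
  have quad: "(\<Sum>i=0..N. q i * lagrange_basis N (int k) (\<xi> i / a)) =
      gauss_expectation (lagrange_poly N a (int k))" if "k \<le> N" for k
    using assms(2) that degree_lagrange_poly[of "int k" N a]
    by (auto simp: gauss_hermite_rule_def gauss_expectation_def poly_lagrange_poly
        dest!: spec[of _ "lagrange_poly N a (int k)"])
  have "(\<forall>n\<in>{0..N}. ?L ((hermite_poly n)\<^sup>2) = fact n) \<longleftrightarrow> exact"
  proof
    assume *: "\<forall>n\<in>{0..N}. ?L ((hermite_poly n)\<^sup>2) = fact n"
    have "?L p - gauss_expectation p = 0" if "degree p \<le> 2 * N" for p
    proof (rule symmetric_functional_eq_0[where N = N and D = "\<lambda>p. ?L p - gauss_expectation p"])
      show "?L (p + r) - gauss_expectation (p + r) =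
          ?L p - gauss_expectation p + (?L r - gauss_expectation r)" for p r
        by (simp add: gauss_expectation_add node_functional_def distrib_left sum.distrib)
      show "?L (smult c p) - gauss_expectation (smult c p) = c * (?L p - gauss_expectation p)" for c p
        by (simp add: gauss_expectation_smult node_functional_def sum_distrib_left right_diff_distrib
            mult.left_commute)
    qed (use * that in \<open>auto simp: node_functional_reflect gauss_expectation_reflect
        gauss_expectation_hermite_square\<close>)
    then show exact by (simp add: exact_def)
  next
    assume exact
    moreover have "degree ((hermite_poly n)\<^sup>2) \<le> 2 * N" if "n \<le> N" for n
      using that degree_power_le[of "hermite_poly n" 2] by (simp add: degree_hermite_poly)
    ultimately show "\<forall>n\<in>{0..N}. ?L ((hermite_poly n)\<^sup>2) = fact n"
      by (simp add: exact_def gauss_expectation_hermite_square)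
  qed
  also have "exact \<longleftrightarrow> (\<forall>k\<in>{0..N}. w k = gauss_expectation (lagrange_poly N a (int k)))"
  proof
    assume exact
    \<comment> \<open>Exactness is tested on the Lagrange polynomials, where \<open>?L\<close>
      returns the single weight w_k.\<close>
    then show "\<forall>k\<in>{0..N}. w k = gauss_expectation (lagrange_poly N a (int k))"
      using assms(1) by (auto simp: exact_def degree_lagrange_poly
          simp flip: node_functional_lagrange[of a _ N w])
  next
    assume *: "\<forall>k\<in>{0..N}. w k = gauss_expectation (lagrange_poly N a (int k))"
    show exact
      unfolding exact_def
    proof (intro allI impI)
      fix p :: "real poly" assume "degree p \<le> 2 * N"
      then have "gauss_expectation p = gauss_expectation
          (\<Sum>j\<in>{- int N..int N}. smult (poly p (of_int j * a)) (lagrange_poly N a j))"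
        using assms(1) lagrange_interpolation[of a p N] by simp
      also have "\<dots> = ?L p"
        unfolding node_functional_def gauss_expectation_sum gauss_expectation_smult
      proof (rule sum.cong)
        fix j assume "j \<in> {- int N..int N}"
        then have "w (nat \<bar>j\<bar>) = gauss_expectation (lagrange_poly N a \<bar>j\<bar>)"
          using * by auto
        then show "poly p (of_int j * a) * gauss_expectation (lagrange_poly N a j) =
            w (nat \<bar>j\<bar>) * poly p (of_int j * a)"
          by (simp add: gauss_expectation_lagrange_abs)
      qed simp
      finally show "?L p = gauss_expectation p" ..
    qed
  qed
  finally show "(\<forall>n\<in>{0..N}. (hermite n 0)\<^sup>2 * w 0 + 2 * (\<Sum>k=1..N. (hermite n (real k * a))\<^sup>2 * w k) = fact n)
    \<longleftrightarrow> (\<forall>k\<in>{0..N}. w k = (\<Sum>i=0..N. q i * lagrange_basis N (int k) (\<xi> i / a)))"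
    by (simp add: node_functional_hermite_square quad)
qed

end
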